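(* Let $T\in \mathcal{B}_A(\mathcal{H})$. Then $$d\omega_A(T) \leq \frac{1}{2}\sqrt{\omega_A\left(\left(T^\sharp T + T\right)^2\right)+\omega_A\left(\left(T^\sharp T - T\right)^2\right)+\omega_A\Big(T^\sharp T + 2(T^\sharp T)^2 + TT^\sharp\Big)}.$$
   Context: $\mathcal{H}$ is a complex Hilbert space with inner product $\langle\cdot\mid\cdot\rangle$, $\mathcal{B}(\mathcal{H})$ is the algebra of bounded linear operators on $\mathcal{H}$, and $A\in\mathcal{B}(\mathcal{H})$ is a fixed nonzero positive (semidefinite) operator. Put $\langle x\mid y\rangle_A=\langle Ax\mid y\rangle$ and $\|x\|_A=\langle x\mid x\rangle_A^{1/2}$. $\mathcal{B}_A(\mathcal{H})=\{T\in\mathcal{B}(\mathcal{H}) : \mathcal{R}(T^*A)\subseteq\mathcal{R}(A)\}$, where $\mathcal{R}$ denotes range; for $T\in\mathcal{B}_A(\mathcal{H})$, $T^\sharp$ denotes the unique $X\in\mathcal{B}(\mathcal{H})$ with $AX=T^*A$ and $\mathcal{R}(X)\subseteq\overline{\mathcal{R}(A)}$ (so $\langle Tx\mid y\rangle_A=\langle x\mid T^\sharp y\rangle_A$). For $T\in\mathcal{B}_A(\mathcal{H})$: $\omega_A(T)=\sup\{|\langle Tx\mid x\rangle_A| : \|x\|_A=1\}$, and the $A$-Davis-Wielandt radius is $d\omega_A(T)=\sup\{\sqrt{|\langle Tx\mid x\rangle_A|^2+\|Tx\|_A^4} : \|x\|_A=1\}$; both are finite. *)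

theory Defs
  imports "HOL-Analysis.Analysis"
begin

class complex_vector = real_vector +
  fixes scaleC :: "complex \<Rightarrow> 'a \<Rightarrow> 'a"  (infixr "*\<^sub>C" 75)
  assumes scaleC_add_right: "c *\<^sub>C (x + y) = c *\<^sub>C x + c *\<^sub>C y"
    and scaleC_add_left: "(c + d) *\<^sub>C x = c *\<^sub>C x + d *\<^sub>C x"
    and scaleC_scaleC: "c *\<^sub>C d *\<^sub>C x = (c * d) *\<^sub>C x"
    and scaleC_one: "1 *\<^sub>C x = x"
    and scaleR_scaleC: "r *\<^sub>R x = complex_of_real r *\<^sub>C x"

text \<open>
  The inner product is linear in its first argument. Positive definiteness
  of \<open>cinner\<close> and \<open>norm x = sqrt (Re (cinner x x))\<close> follow from the real inner product
  axioms through \<open>inner_eq_Re_cinner\<close>; completeness comes from \<open>complete_space\<close>.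
\<close>

class complex_hilbert_space = complex_vector + real_inner + complete_space +
  fixes cinner :: "'a \<Rightarrow> 'a \<Rightarrow> complex"
  assumes cinner_commute: "cinner x y = cnj (cinner y x)"
    and cinner_add_left: "cinner (x + y) z = cinner x z + cinner y z"
    and cinner_scaleC_left: "cinner (c *\<^sub>C x) y = c * cinner x y"
    and inner_eq_Re_cinner: "inner x y = Re (cinner x y)"

instantiation complex :: complex_hilbert_space
begin

definition scaleC_complex :: "complex \<Rightarrow> complex \<Rightarrow> complex"
  where "scaleC_complex c x = c * x"

definition cinner_complex :: "complex \<Rightarrow> complex \<Rightarrow> complex"
  where "cinner_complex x y = x * cnj y"

instance
  by standard
    (simp_all add: scaleC_complex_def cinner_complex_def inner_complex_def
      scaleR_conv_of_real algebra_simps)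

end

definition bounded_clinear :: "('a::complex_hilbert_space \<Rightarrow> 'a) \<Rightarrow> bool"
  where "bounded_clinear T \<longleftrightarrow>
    bounded_linear T \<and> (\<forall>c x. T (c *\<^sub>C x) = c *\<^sub>C T x)"

definition positive_op :: "('a::complex_hilbert_space \<Rightarrow> 'a) \<Rightarrow> bool"
  where "positive_op A \<longleftrightarrow>
    bounded_clinear A \<and> (\<forall>x. cinner (A x) x \<in> \<real> \<and> 0 \<le> Re (cinner (A x) x))"

text \<open>For bounded operators the adjoint exists and is unique by the Riesz representation theorem.\<close>

definition cadjoint :: "('a::complex_hilbert_space \<Rightarrow> 'a) \<Rightarrow> 'a \<Rightarrow> 'a"
  where "cadjoint T = (THE S. \<forall>x y. cinner (T x) y = cinner x (S y))"

definition cinner_A :: "('a::complex_hilbert_space \<Rightarrow> 'a) \<Rightarrow> 'a \<Rightarrow> 'a \<Rightarrow> complex"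
  where "cinner_A A x y = cinner (A x) y"

definition norm_A :: "('a::complex_hilbert_space \<Rightarrow> 'a) \<Rightarrow> 'a \<Rightarrow> real"
  where "norm_A A x = sqrt (Re (cinner_A A x x))"

definition B_A :: "('a::complex_hilbert_space \<Rightarrow> 'a) \<Rightarrow> ('a \<Rightarrow> 'a) set"
  where "B_A A = {T. bounded_clinear T \<and> range (cadjoint T \<circ> A) \<subseteq> range A}"

text \<open>
  For \<open>T \<in> B_A A\<close> the operator below exists by Douglas' theorem, and it is unique because a
  positive \<open>A\<close> is injective on \<open>closure (range A)\<close>.
\<close>

definition sharp_A :: "('a::complex_hilbert_space \<Rightarrow> 'a) \<Rightarrow> ('a \<Rightarrow> 'a) \<Rightarrow> 'a \<Rightarrow> 'a"
  where "sharp_A A T =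
    (THE X. bounded_clinear X \<and> A \<circ> X = cadjoint T \<circ> A \<and> range X \<subseteq> closure (range A))"

text \<open>
  The real suprema below are the mathematical ones for \<open>T \<in> B_A A\<close> and positive \<open>A \<noteq> 0\<close>:
  the sets are then nonempty and bounded above. Outside that range they are unspecified.
\<close>

definition numerical_radius_A :: "('a::complex_hilbert_space \<Rightarrow> 'a) \<Rightarrow> ('a \<Rightarrow> 'a) \<Rightarrow> real"
  where "numerical_radius_A A T = Sup {cmod (cinner_A A (T x) x) | x. norm_A A x = 1}"

definition davis_wielandt_radius_A ::
    "('a::complex_hilbert_space \<Rightarrow> 'a) \<Rightarrow> ('a \<Rightarrow> 'a) \<Rightarrow> real"
  where "davis_wielandt_radius_A A T =
    Sup {sqrt ((cmod (cinner_A A (T x) x))\<^sup>2 + norm_A A (T x) ^ 4) | x. norm_A A x = 1}"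

end

theory Submission
  imports Defs
begin

text \<open>
  Write \<open>S = T\<^sup>\<sharp> T\<close> and let \<open>x\<close> be an \<open>A\<close>-unit vector, so that \<open>\<langle>S x, x\<rangle> = \<parallel>T x\<parallel>\<^sup>2\<close> is real and
  \<open>2 (\<bar>\<langle>T x, x\<rangle>\<bar>\<^sup>2 + \<parallel>T x\<parallel>\<^sup>4) = \<bar>\<langle>(S + T) x, x\<rangle>\<bar>\<^sup>2 + \<bar>\<langle>(S - T) x, x\<rangle>\<bar>\<^sup>2\<close>.
  Buzano's inequality bounds each \<open>\<bar>\<langle>U x, x\<rangle>\<bar>\<^sup>2\<close> by half of
  \<open>\<bar>\<langle>U\<^sup>2 x, x\<rangle>\<bar> + \<parallel>U x\<parallel> \<parallel>U\<^sup>\<sharp> x\<parallel>\<close>, and AM-GM together with the parallelogram law turns the sum of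
  the two norm products into at most \<open>\<langle>(S + 2 S\<^sup>2 + T T\<^sup>\<sharp>) x, x\<rangle>\<close>.

  That the suprema are finite uses \<open>A\<close>-boundedness of the \<open>A\<close>-selfadjoint operators \<open>T\<^sup>\<sharp> T\<close> and
  \<open>T T\<^sup>\<sharp>\<close>, obtained by iterating the Cauchy-Schwarz inequality. The operator \<open>T\<^sup>\<sharp>\<close> is obtained
  pointwise by orthogonal projection onto the closure of the range of \<open>A\<close>, and its boundedness
  from the Baire category theorem.
\<close>

section \<open>Orthogonal projection and Riesz representation in real Hilbert spaces\<close>

text \<open>The parallelogram law makes a distance-minimizing sequence Cauchy, so completeness and
  closedness give a nearest point \<open>m\<close>. Moving \<open>m\<close> within \<open>M\<close>
  cannot decrease the distance, which forces orthogonality.\<close>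

lemma orthogonal_projection_exists:
  fixes M :: "'a::{real_inner,complete_space} set"
  assumes "subspace M" "closed M"
  obtains m where "m \<in> M" "\<And>u. u \<in> M \<Longrightarrow> inner (x - m) u = 0"
proof -
  define D where "D = (INF m\<in>M. (norm (x - m))\<^sup>2)"
  have "0 \<in> M"
    using assms(1) by (rule subspace_0)
  have bdd: "bdd_below ((\<lambda>m. (norm (x - m))\<^sup>2) ` M)"
    by (rule bdd_belowI2[of _ 0]) simp
  have D_le: "D \<le> (norm (x - m))\<^sup>2" if "m \<in> M" for m
    unfolding D_def using bdd that by (rule cINF_lower)
  have "\<exists>m\<in>M. (norm (x - m))\<^sup>2 < D + 1 / real (Suc k)" for k
  proof -
    have "D < D + 1 / real (Suc k)" by simp
    then show ?thesis
      using cINF_less_iff[OF _ bdd] \<open>0 \<in> M\<close> unfolding D_def by blast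
  qed
  then obtain f where fM: "\<And>k. f k \<in> M"
    and f: "\<And>k. (norm (x - f k))\<^sup>2 < D + 1 / real (Suc k)"
    by metis
  \<comment> \<open>The midpoint of \<open>f j\<close> and \<open>f k\<close> lies in
    \<open>M\<close>, so its squared distance to \<open>x\<close> is at least \<open>D\<close>; the
    parallelogram law turns this into closeness of \<open>f j\<close> and
    \<open>f k\<close>.\<close>
  have dist: "(dist (f j) (f k))\<^sup>2 \<le> 2 / real (Suc j) + 2 / real (Suc k)" for j k
  proof -
    have "(1/2) *\<^sub>R (f j + f k) \<in> M"
      using fM assms(1) by (simp add: subspace_add subspace_scale)
    then have "D \<le> (norm (x - (1/2) *\<^sub>R (f j + f k)))\<^sup>2"
      by (rule D_le)
    moreover have "(dist (f j) (f k))\<^sup>2 = 2 * (norm (x - f j))\<^sup>2 + 2 * (norm (x - f k))\<^sup>2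
        - 4 * (norm (x - (1/2) *\<^sub>R (f j + f k)))\<^sup>2"
      unfolding dist_norm power2_norm_eq_inner
      by (simp add: algebra_simps inner_commute)
    ultimately show ?thesis
      using f[of j] f[of k] by simp
  qed
  have "Cauchy f"
  proof (rule metric_CauchyI)
    fix e :: real assume "e > 0"
    then obtain N where N: "4 / e\<^sup>2 < real N"
      using reals_Archimedean2 by blast
    have "dist (f j) (f k) < e" if "j \<ge> N" "k \<ge> N" for j k
    proof -
      have *: "1 / real (Suc i) < e\<^sup>2 / 4" if "i \<ge> N" for i
      proof -
        have "4 / e\<^sup>2 < real (Suc i)" using N that by simp
        then show ?thesis using \<open>e > 0\<close> by (simp add: field_simps)
      qed
      have "(dist (f j) (f k))\<^sup>2 < e\<^sup>2"
        using dist[of j k] *[OF that(1)] *[OF that(2)] by simp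
      then show ?thesis
        using \<open>e > 0\<close> by (simp add: power2_less_imp_less)
    qed
    then show "\<exists>N. \<forall>j\<ge>N. \<forall>k\<ge>N. dist (f j) (f k) < e" by blast
  qed
  then obtain m where m: "f \<longlonglongrightarrow> m"
    using Cauchy_convergent convergent_def by blast
  have "m \<in> M"
    using closed_sequentially[OF assms(2)] fM m by blast
  have "(norm (x - m))\<^sup>2 \<le> D"
  proof (rule LIMSEQ_le)
    show "(\<lambda>k. (norm (x - f k))\<^sup>2) \<longlonglongrightarrow> (norm (x - m))\<^sup>2"
      by (intro tendsto_intros m)
    show "(\<lambda>k. D + 1 / real (Suc k)) \<longlonglongrightarrow> D"
      using tendsto_add[OF tendsto_const LIMSEQ_Suc[OF lim_1_over_n[where 'a=real]]] by simp
    show "\<exists>N. \<forall>k\<ge>N. (norm (x - f k))\<^sup>2 \<le> D + 1 / real (Suc k)"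
      using f by (meson less_imp_le)
  qed
  have "inner (x - m) u = 0" if "u \<in> M" for u
  proof (cases "u = 0")
    case False
    \<comment> \<open>This \<open>t\<close> minimizes the norm of
      \<open>x - m - t *\<^sub>R u\<close> over real \<open>t\<close>.\<close>
    define t where "t = inner (x - m) u / inner u u"
    have u: "inner u u > 0" using False by simp
    have "m + t *\<^sub>R u \<in> M"
      using \<open>m \<in> M\<close> that assms(1) by (simp add: subspace_add subspace_scale)
    then have "(norm (x - m))\<^sup>2 \<le> (norm ((x - m) - t *\<^sub>R u))\<^sup>2"
      using D_le[of "m + t *\<^sub>R u"] \<open>(norm (x - m))\<^sup>2 \<le> D\<close>
      unfolding diff_diff_eq by (meson order_trans)
    also have "\<dots> = (norm (x - m))\<^sup>2 - 2 * t * inner (x - m) u + t * t * inner u u"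
      unfolding power2_norm_eq_inner inner_diff_left[of "x - m" _ "x - m - t *\<^sub>R u"]
      by (simp add: inner_diff_right[of _ "x - m"] inner_commute[of u "x - m"])
    also have "t * t * inner u u = t * inner (x - m) u"
      using u by (simp add: t_def)
    finally have "(inner (x - m) u)\<^sup>2 / inner u u \<le> 0"
      by (simp add: t_def power2_eq_square)
    then show ?thesis
      using u by (simp add: divide_le_0_iff)
  qed simp
  with \<open>m \<in> M\<close> show thesis by (rule that)
qed

lemma subspace_closure:
  fixes S :: "'a::real_normed_vector set"
  assumes "subspace S"
  shows "subspace (closure S)"
proof (rule subspaceI)
  show "0 \<in> closure S"
    using subspace_0[OF assms] closure_subset by blast
next
  fix x y assume "x \<in> closure S" "y \<in> closure S"
  then obtain f g where "\<And>n. f n \<in> S" "f \<longlonglongrightarrow> x" "\<And>n. g n \<in> S" "g \<longlonglongrightarrow> y"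
    unfolding closure_sequential by blast
  then show "x + y \<in> closure S"
    unfolding closure_sequential
    by (intro exI[of _ "\<lambda>n. f n + g n"]) (auto intro: subspace_add[OF assms] tendsto_add)
next
  fix c :: real and x assume "x \<in> closure S"
  then obtain f where "\<And>n. f n \<in> S" "f \<longlonglongrightarrow> x"
    unfolding closure_sequential by blast
  then show "c *\<^sub>R x \<in> closure S"
    unfolding closure_sequential
    by (intro exI[of _ "\<lambda>n. c *\<^sub>R f n"]) (auto intro: subspace_scale[OF assms] tendsto_scaleR)
qed

text \<open>The kernel of a nonzero \<open>f\<close> has codimension one, so a vector
  \<open>z\<close> orthogonal to it represents \<open>f\<close> up to a scalar.\<close>

lemma riesz_representation:
  fixes f :: "'a::{real_inner,complete_space} \<Rightarrow> real"
  assumes "bounded_linear f"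
  obtains v where "\<And>x. f x = inner x v"
proof (cases "\<forall>x. f x = 0")
  case True
  then show thesis using that[of 0] by simp
next
  case False
  interpret bounded_linear f by fact
  from False obtain x where x: "f x \<noteq> 0" by blast
  have "subspace {u. f u = 0}"
    by (simp add: subspace_def add scaleR zero)
  moreover have "closed {u. f u = 0}"
    by (intro closed_Collect_eq continuous_on continuous_intros)
  ultimately obtain m where m: "f m = 0" "\<And>u. f u = 0 \<Longrightarrow> inner (x - m) u = 0"
    using orthogonal_projection_exists[of "{u. f u = 0}" x] by auto
  define z where "z = x - m"
  have fz: "f z \<noteq> 0" using x m(1) by (simp add: z_def diff)
  then have z: "inner z z \<noteq> 0" using zero by auto
  \<comment> \<open>Subtracting the right multiple of \<open>z\<close> moves \<open>y\<close> into
    the kernel, which is orthogonal to \<open>z\<close>.\<close>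
  have "f y = inner y ((f z / inner z z) *\<^sub>R z)" for y
  proof -
    have "f (y - (f y / f z) *\<^sub>R z) = 0"
      using fz by (simp add: diff scaleR)
    then have "inner z (y - (f y / f z) *\<^sub>R z) = 0"
      using m(2) by (simp add: z_def)
    then show ?thesis
      using fz z by (simp add: inner_diff_right inner_commute field_simps)
  qed
  then show thesis by (rule that)
qed


section \<open>Boundedness of linear maps and growth of their iterates\<close>

text \<open>The sublevel sets cover a complete space, so by Baire one of them contains a ball;
  linearity carries the bound on that ball to all vectors.\<close>

lemma bounded_linear_if_closed_sublevels:
  fixes X :: "'a::{real_normed_vector,complete_space} \<Rightarrow> 'b::real_normed_vector"
  assumes "linear X" and closed: "\<And>k::nat. closed {x. norm (X x) \<le> real k}"
  shows "bounded_linear X"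
proof -
  interpret linear X by fact
  define E where "E k = {x. norm (X x) \<le> real k}" for k :: nat
  have "\<exists>k. interior (E k) \<noteq> {}"
  proof (rule ccontr)
    assume "\<nexists>k. interior (E k) \<noteq> {}"
    then have "interior (\<Union> (range E)) = {}"
      using Met_TC.metric_Baire_category_alt[where 'a='a and \<G>="range E"] closed
      by (auto simp: complete_UNIV E_def)
    moreover have "\<Union> (range E) = UNIV"
      by (auto simp: E_def real_arch_simple)
    ultimately show False by simp
  qed
  then obtain k a where "a \<in> interior (E k)" by blast
  then obtain r where "r > 0" and r: "cball a r \<subseteq> E k"
    by (meson mem_interior_cball)
  have "norm (X h) \<le> norm h * (2 * real k / r)" for h
  proof (cases "h = 0")
    case True
    then show ?thesis by (simp add: zero)
  next
    case False
    define c where "c = r / norm h"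
    have "c > 0" using False \<open>r > 0\<close> by (simp add: c_def)
    \<comment> \<open>The factor \<open>c\<close> scales \<open>h\<close> to length
      \<open>r\<close>, so both the centre and the displaced point lie in the ball.\<close>
    have "a \<in> E k" "a + c *\<^sub>R h \<in> E k"
      using r \<open>r > 0\<close> False by (auto simp: c_def dist_norm)
    then have "norm (X (a + c *\<^sub>R h) - X a) \<le> 2 * real k"
      using norm_triangle_ineq4[of "X (a + c *\<^sub>R h)" "X a"] by (simp add: E_def)
    then have "c * norm (X h) \<le> 2 * real k"
      using \<open>c > 0\<close> by (simp add: add scaleR)
    then show ?thesis
      using False \<open>r > 0\<close> by (simp add: c_def field_simps)
  qed
  with add scaleR show ?thesis by (rule bounded_linear_intro)
qed

lemma bounded_linear_funpow_bound:
  fixes S :: "'a::real_normed_vector \<Rightarrow> 'a"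
  assumes "bounded_linear S"
  obtains M where "M \<ge> 0" "\<And>k x. norm ((S ^^ k) x) \<le> M ^ k * norm x"
proof -
  obtain M where "M \<ge> 0" and M: "\<And>x. norm (S x) \<le> norm x * M"
    using bounded_linear.nonneg_bounded[OF assms] by blast
  have "norm ((S ^^ k) x) \<le> M ^ k * norm x" for k x
  proof (induction k)
    case (Suc k)
    have "norm ((S ^^ Suc k) x) \<le> norm ((S ^^ k) x) * M"
      using M by simp
    also have "\<dots> \<le> (M ^ k * norm x) * M"
      using Suc \<open>M \<ge> 0\<close> by (rule mult_right_mono)
    finally show ?case by (simp add: mult_ac)
  qed simp
  with \<open>M \<ge> 0\<close> show thesis by (rule that)
qed

section \<open>Complex semi-inner products and the pointwise inequality\<close>

locale csemi_inner =
  fixes s :: "'a::complex_vector \<Rightarrow> 'a \<Rightarrow> complex"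
  assumes add_left: "s (x + y) z = s x z + s y z"
    and scaleC_left: "s (c *\<^sub>C x) y = c * s x y"
    and commute: "s x y = cnj (s y x)"
    and nonneg: "0 \<le> Re (s x x)"
begin

definition snorm :: "'a \<Rightarrow> real"
  where "snorm x = sqrt (Re (s x x))"

lemma add_right: "s z (x + y) = s z x + s z y"
  by (metis add_left commute complex_cnj_add)

lemma scaleC_right: "s x (c *\<^sub>C y) = cnj c * s x y"
  by (metis scaleC_left commute complex_cnj_mult)

lemma minus_left: "s (- x) y = - s x y"
proof -
  have "- x = complex_of_real (-1) *\<^sub>C x"
    by (subst scaleR_scaleC[symmetric]) simp
  then show ?thesis by (simp add: scaleC_left)
qed

lemma minus_right: "s x (- y) = - s x y"
  by (metis minus_left commute complex_cnj_minus)

lemma diff_left: "s (x - y) z = s x z - s y z"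
  using add_left[of x "- y"] by (simp add: minus_left)

lemma diff_right: "s z (x - y) = s z x - s z y"
  using add_right[of z x "- y"] by (simp add: minus_right)

lemmas sesquilinear = add_left add_right diff_left diff_right scaleC_left scaleC_right

lemma snorm_nonneg: "0 \<le> snorm x"
  by (simp add: snorm_def nonneg)

lemma snorm_sq: "(snorm x)\<^sup>2 = Re (s x x)"
  by (simp add: snorm_def nonneg)

lemma self: "s x x = complex_of_real ((snorm x)\<^sup>2)"
proof -
  have "Im (s x x) = 0"
    using commute[of x x] by (metis add.inverse_inverse cnj.simps(2) equal_neg_zero)
  then show ?thesis by (simp add: snorm_sq complex_eq_iff)
qed

text \<open>The seminorm of \<open>x - c *\<^sub>C y\<close> is nonnegative when \<open>c\<close> is
  a real multiple \<open>t\<close> of \<open>s x y\<close>, which gives a quadratic inequality in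
  \<open>t\<close>. Since \<open>snorm y\<close> may vanish for nonzero \<open>y\<close>, that case
  is treated separately.\<close>

lemma cauchy_schwarz: "cmod (s x y) \<le> snorm x * snorm y"
proof -
  define b where "b = (cmod (s x y))\<^sup>2"
  have b: "complex_of_real b = s x y * cnj (s x y)"
    unfolding b_def by (rule complex_norm_square)
  have key: "0 \<le> (snorm x)\<^sup>2 - 2 * t * b + t\<^sup>2 * b * (snorm y)\<^sup>2" for t :: real
  proof -
    define c where "c = complex_of_real t * s x y"
    have "s (x - c *\<^sub>C y) (x - c *\<^sub>C y)
        = s x x - cnj c * s x y - c * s y x + c * cnj c * s y y"
      by (simp add: sesquilinear algebra_simps)
    also have "cnj c * s x y = complex_of_real (t * b)"
      by (simp add: c_def b mult_ac)
    also have "c * s y x = complex_of_real (t * b)"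
      by (simp add: c_def b commute[of y x] mult_ac)
    also have "c * cnj c = complex_of_real (t\<^sup>2 * b)"
      by (simp add: c_def b power2_eq_square mult_ac)
    finally have "Re (s (x - c *\<^sub>C y) (x - c *\<^sub>C y))
        = (snorm x)\<^sup>2 - 2 * t * b + t\<^sup>2 * b * (snorm y)\<^sup>2"
      by (simp add: self)
    then show ?thesis by (metis nonneg)
  qed
  have "b \<le> (snorm x)\<^sup>2 * (snorm y)\<^sup>2"
  proof (cases "snorm y = 0")
    case True
    \<comment> \<open>Without the quadratic term, the chosen \<open>t\<close> would make the
      right-hand side of \<open>key\<close> equal to -1.\<close>
    have "b = 0"
    proof (rule ccontr)
      assume "b \<noteq> 0"
      then show False
        using key[of "((snorm x)\<^sup>2 + 1) / (2 * b)"] True by (simp add: field_simps)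
    qed
    then show ?thesis by simp
  next
    case False
    then have "0 < (snorm y)\<^sup>2" by simp
    \<comment> \<open>The minimum of the quadratic is attained at this \<open>t\<close>.\<close>
    then show ?thesis
      using key[of "1 / (snorm y)\<^sup>2"] by (simp add: divide_simps power2_eq_square split: if_splits)
  qed
  then show ?thesis
    unfolding b_def power_mult_distrib[symmetric]
    using snorm_nonneg by (meson mult_nonneg_nonneg power2_le_imp_le)
qed

lemma parallelogram:
  "(snorm (x + y))\<^sup>2 + (snorm (x - y))\<^sup>2 = 2 * (snorm x)\<^sup>2 + 2 * (snorm y)\<^sup>2"
  by (simp add: snorm_sq sesquilinear)

lemma snorm_add_le: "snorm (x + y) \<le> snorm x + snorm y"
proof (rule power2_le_imp_le)
  have "(snorm (x + y))\<^sup>2 = (snorm x)\<^sup>2 + 2 * Re (s x y) + (snorm y)\<^sup>2"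
    using commute[of y x] by (simp add: snorm_sq sesquilinear)
  also have "Re (s x y) \<le> snorm x * snorm y"
    using cauchy_schwarz complex_Re_le_cmod order_trans by blast
  finally show "(snorm (x + y))\<^sup>2 \<le> (snorm x + snorm y)\<^sup>2"
    by (simp add: power2_sum)
qed (simp add: snorm_nonneg)

lemma snorm_minus: "snorm (- x) = snorm x"
  by (simp add: snorm_def minus_left minus_right)

lemma snorm_diff_le: "snorm (x - y) \<le> snorm x + snorm y"
  using snorm_add_le[of x "- y"] by (simp add: snorm_minus)

text \<open>The vector \<open>2 \<langle>x, e\<rangle> e - x\<close> is a reflection of \<open>x\<close>, hence as long as \<open>x\<close>.\<close>

lemma buzano:
  assumes "snorm e = 1"
  shows "cmod (s x e * s e y) \<le> (cmod (s x y) + snorm x * snorm y) / 2"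
proof -
  define w where "w = (2 * s x e) *\<^sub>C e - x"
  have "s w w = s x x + s x e * (4 * cnj (s x e) * s e e - 2 * s e x - 2 * cnj (s x e))"
    by (simp add: w_def sesquilinear algebra_simps)
  also have "\<dots> = s x x"
    using commute[of e x] self[of e] assms by simp
  finally have "snorm w = snorm x"
    by (simp add: snorm_def)
  then have "cmod (s w y) \<le> snorm x * snorm y"
    by (metis cauchy_schwarz)
  moreover have "2 * (s x e * s e y) = s w y + s x y"
    by (simp add: w_def sesquilinear)
  then have "2 * cmod (s x e * s e y) \<le> cmod (s w y) + cmod (s x y)"
    by (metis norm_mult norm_numeral norm_triangle_ineq)
  ultimately show ?thesis by simp
qed

text \<open>Buzano's inequality is applied to \<open>U x\<close> and \<open>V x\<close> with
  \<open>e = x\<close>: by adjointness both factors on the left equal \<open>s (U x) x\<close>, and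
  \<open>s (U x) (V x)\<close> equals \<open>s (U (U x)) x\<close>.\<close>

lemma numerical_value_sq_le:
  assumes adj: "\<And>x y. s (U x) y = s x (V y)" and "snorm x = 1"
  shows "(cmod (s (U x) x))\<^sup>2 \<le> (cmod (s (U (U x)) x) + snorm (U x) * snorm (V x)) / 2"
  using buzano[OF assms(2), of "U x" "V x"]
  by (simp add: adj[of x x, symmetric] adj[of "U x" x] norm_mult power2_eq_square)

lemma davis_wielandt_pointwise:
  assumes adj: "\<And>x y. s (T x) y = s x (X y)" and "snorm x = 1"
  shows "(cmod (s (T x) x))\<^sup>2 + snorm (T x) ^ 4 \<le>
    (cmod (s (((\<lambda>x. X (T x) + T x) ^^ 2) x) x)
      + cmod (s (((\<lambda>x. X (T x) - T x) ^^ 2) x) x)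
      + cmod (s (X (T x) + 2 *\<^sub>C X (T (X (T x))) + T (X x)) x)) / 4"
proof -
  define S where "S = (\<lambda>x. X (T x))"
  have adj': "s (X x) y = s x (T y)" for x y
    by (metis adj commute)
  have sym: "s (S x) y = s x (S y)" for x y
    by (simp add: S_def adj adj')
  define U where "U = (\<lambda>x. S x + T x)"
  define V where "V = (\<lambda>x. S x - T x)"
  \<comment> \<open>As \<open>S\<close> is symmetric and \<open>X\<close> is adjoint to
    \<open>T\<close>, the adjoints of \<open>S + T\<close> and \<open>S - T\<close> are
    \<open>S + X\<close> and \<open>S - X\<close>.\<close>
  have "(cmod (s (U x) x))\<^sup>2
      \<le> (cmod (s (U (U x)) x) + snorm (S x + T x) * snorm (S x + X x)) / 2"
    using numerical_value_sq_le[of U "\<lambda>x. S x + X x"] assms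
    by (simp add: U_def sesquilinear sym)
  moreover have "(cmod (s (V x) x))\<^sup>2
      \<le> (cmod (s (V (V x)) x) + snorm (S x - T x) * snorm (S x - X x)) / 2"
    using numerical_value_sq_le[of V "\<lambda>x. S x - X x"] assms
    by (simp add: V_def sesquilinear sym)
  moreover have "2 * (snorm (S x + T x) * snorm (S x + X x))
      + 2 * (snorm (S x - T x) * snorm (S x - X x))
      \<le> 4 * (snorm (S x))\<^sup>2 + 2 * (snorm (T x))\<^sup>2 + 2 * (snorm (X x))\<^sup>2"
    using sum_squares_bound[of "snorm (S x + T x)" "snorm (S x + X x)"]
      sum_squares_bound[of "snorm (S x - T x)" "snorm (S x - X x)"]
      parallelogram[of "S x" "T x"] parallelogram[of "S x" "X x"]
    by (simp add: mult.assoc)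
  moreover have "2 * (snorm (S x))\<^sup>2 + (snorm (T x))\<^sup>2 + (snorm (X x))\<^sup>2
      \<le> cmod (s (S x + 2 *\<^sub>C S (S x) + T (X x)) x)"
  proof -
    have "s (S x + 2 *\<^sub>C S (S x) + T (X x)) x
        = s (T x) (T x) + 2 * s (S x) (S x) + s (X x) (X x)"
      by (simp add: sesquilinear sym[of "S x"] adj[of "X x"]) (simp add: S_def adj')
    then have "Re (s (S x + 2 *\<^sub>C S (S x) + T (X x)) x)
        = 2 * (snorm (S x))\<^sup>2 + (snorm (T x))\<^sup>2 + (snorm (X x))\<^sup>2"
      by (simp add: snorm_sq)
    then show ?thesis by (metis complex_Re_le_cmod)
  qed
  \<comment> \<open>This is the parallelogram law for the complex numbers \<open>s (S x) x\<close>
    and \<open>s (T x) x\<close>; the first is real with square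
    \<open>snorm (T x) ^ 4\<close>.\<close>
  moreover have "(cmod (s (U x) x))\<^sup>2 + (cmod (s (V x) x))\<^sup>2
      = 2 * ((cmod (s (T x) x))\<^sup>2 + snorm (T x) ^ 4)"
  proof -
    have Sx: "s (S x) x = complex_of_real ((snorm (T x))\<^sup>2)"
      by (simp add: S_def adj' self)
    show ?thesis
      unfolding U_def V_def add_left diff_left Sx
      by (simp add: cmod_power2 power2_sum power2_diff flip: of_real_power)
  qed
  ultimately show ?thesis
    by (simp add: U_def V_def S_def numeral_2_eq_2)
qed

text \<open>
  Iterating \<open>\<parallel>S x\<parallel>\<^sup>2 = \<langle>S\<^sup>2 x, x\<rangle> \<le> \<parallel>S\<^sup>2 x\<parallel>\<close> gives \<open>\<parallel>S x\<parallel>\<^sup>N \<le> \<parallel>S\<^sup>N x\<parallel>\<close> for powers \<open>N\<close> of two, so the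
  factor \<open>K\<close> disappears on taking \<open>N\<close>-th roots.
\<close>

lemma symmetric_snorm_le:
  assumes sym: "\<And>x y. s (S x) y = s x (S y)" and "snorm x = 1"
    and bound: "\<And>k. snorm ((S ^^ k) x) \<le> K * M ^ k" and "M \<ge> 0"
  shows "snorm (S x) \<le> M"
proof (rule ccontr)
  assume "\<not> snorm (S x) \<le> M"
  then have less: "M < snorm (S x)" by simp
  have sym_pow: "s ((S ^^ k) x) y = s x ((S ^^ k) y)" for k x y
    by (induction k arbitrary: x y) (simp_all add: sym funpow_swap1)
  have dbl: "(snorm ((S ^^ k) x))\<^sup>2 \<le> snorm ((S ^^ (2 * k)) x)" for k
  proof -
    have "(snorm ((S ^^ k) x))\<^sup>2 = Re (s x ((S ^^ (2 * k)) x))"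
      by (simp add: snorm_sq sym_pow mult_2 funpow_add)
    also have "\<dots> \<le> snorm x * snorm ((S ^^ (2 * k)) x)"
      using cauchy_schwarz complex_Re_le_cmod order_trans by blast
    finally show ?thesis by (simp add: assms(2))
  qed
  have iter: "snorm (S x) ^ (2 ^ j) \<le> snorm ((S ^^ (2 ^ j)) x)" for j
  proof (induction j)
    case (Suc j)
    have "snorm (S x) ^ (2 ^ Suc j) = (snorm (S x) ^ (2 ^ j))\<^sup>2"
      by (simp add: power_mult[symmetric] mult.commute)
    also have "\<dots> \<le> (snorm ((S ^^ (2 ^ j)) x))\<^sup>2"
      using Suc snorm_nonneg by (simp add: power_mono)
    also have "\<dots> \<le> snorm ((S ^^ (2 ^ Suc j)) x)"
      using dbl by simp
    finally show ?case .
  qed simp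
  show False
  proof (cases "M = 0")
    case True
    then show False
      using bound[of 1] less by simp
  next
    case False
    define q where "q = snorm (S x) / M"
    have "q > 1" using less False \<open>M \<ge> 0\<close> by (simp add: q_def)
    have "q ^ (2 ^ j) \<le> K" for j
      using order_trans[OF iter bound] False \<open>M \<ge> 0\<close>
      by (simp add: q_def power_divide pos_divide_le_eq)
    moreover obtain m where "K < q ^ m"
      using real_arch_pow[OF \<open>q > 1\<close>] by blast
    \<comment> \<open>Only exponents that are powers of two are controlled, so \<open>m\<close> is
      replaced by the larger \<open>2 ^ m\<close>.\<close>
    moreover have "q ^ m \<le> q ^ (2 ^ m)"
      using \<open>q > 1\<close> less_exp[of m] by (intro power_increasing) auto
    ultimately show False by (meson not_le order_trans)
  qed
qed

text \<open>Moving one factor \<open>U\<close> to the other side as \<open>V\<close> leaves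
  operators applied to \<open>x\<close> alone, so bounds on unit vectors suffice even though
  \<open>U x\<close> need not be a unit vector.\<close>

lemma numerical_value_sq_bounded:
  assumes adj: "\<And>x y. s (U x) y = s x (V y)"
    and U: "\<And>x. snorm x = 1 \<Longrightarrow> snorm (U x) \<le> C"
    and V: "\<And>x. snorm x = 1 \<Longrightarrow> snorm (V x) \<le> C"
    and "snorm x = 1"
  shows "cmod (s ((U ^^ 2) x) x) \<le> C * C"
proof -
  have "cmod (s (U x) (V x)) \<le> snorm (U x) * snorm (V x)"
    by (rule cauchy_schwarz)
  also have "\<dots> \<le> C * C"
    using U V assms(4) snorm_nonneg by (meson mult_mono order_trans)
  finally show ?thesis by (simp add: numeral_2_eq_2 adj)
qed

end


section \<open>The complex inner product and the adjoint\<close>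

lemma cinner_scaleC_right:
  fixes x y :: "'a::complex_hilbert_space"
  shows "cinner x (c *\<^sub>C y) = cnj c * cinner x y"
  by (metis cinner_commute cinner_scaleC_left complex_cnj_mult)

lemma cinner_add_right:
  fixes x y z :: "'a::complex_hilbert_space"
  shows "cinner x (y + z) = cinner x y + cinner x z"
  by (metis cinner_commute cinner_add_left complex_cnj_add)

lemma norm_scaleC:
  fixes x :: "'a::complex_hilbert_space"
  shows "norm (c *\<^sub>C x) = cmod c * norm x"
proof -
  have "cinner (c *\<^sub>C x) (c *\<^sub>C x) = complex_of_real ((cmod c)\<^sup>2) * cinner x x"
    unfolding complex_norm_square by (simp add: cinner_scaleC_left cinner_scaleC_right)
  then have "(norm (c *\<^sub>C x))\<^sup>2 = (cmod c)\<^sup>2 * (norm x)\<^sup>2"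
    unfolding power2_norm_eq_inner inner_eq_Re_cinner by (simp flip: of_real_power)
  then show ?thesis
    by (simp flip: power_mult_distrib)
qed

lemma bounded_linear_scaleC: "bounded_linear ((*\<^sub>C) c :: 'a::complex_hilbert_space \<Rightarrow> 'a)"
  by (rule bounded_linear_intro[where K = "cmod c"])
    (simp_all add: scaleC_add_right scaleR_scaleC scaleC_scaleC norm_scaleC mult.commute)

text \<open>Replacing \<open>x\<close> by \<open>\<i> *\<^sub>C x\<close> recovers the imaginary
  parts from the real ones. This lets the real Riesz theorem produce complex adjoints.\<close>

lemma cinner_eq_iff_inner:
  fixes v w :: "'a::complex_hilbert_space"
  assumes "\<And>c x. S (c *\<^sub>C x) = c *\<^sub>C S x"
  shows "(\<forall>x. cinner (S x) v = cinner x w) \<longleftrightarrow> (\<forall>x. inner (S x) v = inner x w)"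
proof (intro iffI allI)
  fix x assume eq: "\<forall>x. inner (S x) v = inner x w"
  have "inner (S (\<i> *\<^sub>C x)) v = inner (\<i> *\<^sub>C x) w"
    using eq by blast
  then have "Im (cinner (S x) v) = Im (cinner x w)"
    by (simp add: assms inner_eq_Re_cinner cinner_scaleC_left)
  then show "cinner (S x) v = cinner x w"
    using eq by (simp add: complex_eq_iff inner_eq_Re_cinner)
qed (simp add: inner_eq_Re_cinner)

lemma cinner_cadjoint:
  fixes T :: "'a::complex_hilbert_space \<Rightarrow> 'a"
  assumes "bounded_clinear T"
  shows "cinner (T x) y = cinner x (cadjoint T y)"
proof -
  have T: "bounded_linear T" "\<And>c x. T (c *\<^sub>C x) = c *\<^sub>C T x"
    using assms by (auto simp: bounded_clinear_def)
  have "\<exists>v. \<forall>x. inner (T x) y = inner x v" for y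
    using riesz_representation[of "\<lambda>x. inner (T x) y"]
      bounded_linear_inner_left_comp[OF T(1)] by metis
  then obtain S where "\<And>x y. inner (T x) y = inner x (S y)" by metis
  then have S: "\<forall>x y. cinner (T x) y = cinner x (S y)"
    using cinner_eq_iff_inner[OF T(2)] by blast
  have "\<exists>!S. \<forall>x y. cinner (T x) y = cinner x (S y)"
  proof (rule ex1I[of _ S])
    fix R assume R: "\<forall>x y. cinner (T x) y = cinner x (R y)"
    have "R y = S y" for y
    proof -
      have "cinner x (R y) = cinner x (S y)" for x
        using R S by metis
      then have "inner x (R y) = inner x (S y)" for x
        by (simp add: inner_eq_Re_cinner)
      then show ?thesis by (metis vector_eq_ldot)
    qed
    then show "R = S" by blast
  qed (rule S)
  then have "\<forall>x y. cinner (T x) y = cinner x (cadjoint T y)"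
    unfolding cadjoint_def by (rule theI')
  then show ?thesis by blast
qed

section \<open>Positive operators, their semi-inner product and the A-adjoint\<close>

text \<open>Polarization: reality of the quadratic form at \<open>x + y\<close> and at
  \<open>x + \<i> *\<^sub>C y\<close> relates the imaginary and the real parts of
  \<open>cinner (A x) y\<close> and \<open>cinner (A y) x\<close>.\<close>

lemma positive_op_self_adjoint:
  fixes A :: "'a::complex_hilbert_space \<Rightarrow> 'a"
  assumes "positive_op A"
  shows "cinner (A x) y = cinner x (A y)"
proof -
  have A: "A (x + y) = A x + A y" "A (c *\<^sub>C x) = c *\<^sub>C A x" for c x y
    using assms by (auto simp: positive_op_def bounded_clinear_def bounded_linear.linear linear_add)
  have im: "Im (cinner (A z) z) = 0" for z
    using assms by (simp add: positive_op_def complex_is_Real_iff)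
  have "Im (cinner (A x) y + cinner (A y) x) = 0"
    using im[of "x + y"] im[of x] im[of y] by (simp add: A cinner_add_left cinner_add_right)
  moreover have "Re (cinner (A y) x) = Re (cinner (A x) y)"
    using im[of "x + \<i> *\<^sub>C y"] im[of x] im[of y]
    by (simp add: A cinner_add_left cinner_add_right cinner_scaleC_left cinner_scaleC_right)
  ultimately have "cinner (A x) y = cnj (cinner (A y) x)"
    by (simp add: complex_eq_iff)
  then show ?thesis by (simp flip: cinner_commute)
qed

lemma csemi_inner_cinner_A:
  fixes A :: "'a::complex_hilbert_space \<Rightarrow> 'a"
  assumes "positive_op A"
  shows "csemi_inner (cinner_A A)"
proof
  have A: "A (x + y) = A x + A y" "A (c *\<^sub>C x) = c *\<^sub>C A x" for c x y
    using assms by (auto simp: positive_op_def bounded_clinear_def bounded_linear.linear linear_add)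
  fix c and x y z :: 'a
  show "cinner_A A (x + y) z = cinner_A A x z + cinner_A A y z"
    by (simp add: cinner_A_def A cinner_add_left)
  show "cinner_A A (c *\<^sub>C x) y = c * cinner_A A x y"
    by (simp add: cinner_A_def A cinner_scaleC_left)
  show "cinner_A A x y = cnj (cinner_A A y x)"
    by (simp add: cinner_A_def positive_op_self_adjoint[OF assms, of x] flip: cinner_commute)
  show "0 \<le> Re (cinner_A A x x)"
    using assms by (simp add: cinner_A_def positive_op_def)
qed

text \<open>
  The sublevel set \<open>\<parallel>X x\<parallel> \<le> k\<close> is cut out by the conditions
  \<open>\<bar>\<langle>x, A (T w)\<rangle>\<bar> = \<bar>\<langle>X x, A w\<rangle>\<bar> \<le> k \<parallel>A w\<parallel>\<close>, because \<open>X x\<close> lies in the closure of the range of \<open>A\<close>.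
\<close>

lemma sharp_A_bounded_clinear:
  fixes A T :: "'a::complex_hilbert_space \<Rightarrow> 'a"
  assumes "positive_op A" "T \<in> B_A A"
  shows "bounded_clinear (sharp_A A T)" "A (sharp_A A T x) = cadjoint T (A x)"
proof -
  have A: "bounded_linear A" "\<And>c x. A (c *\<^sub>C x) = c *\<^sub>C A x"
    using assms(1) by (auto simp: positive_op_def bounded_clinear_def)
  have T: "bounded_clinear T" and ran: "range (cadjoint T \<circ> A) \<subseteq> range A"
    using assms(2) by (auto simp: B_A_def)
  have A_inner: "inner (A x) y = inner x (A y)" for x y
    by (simp add: inner_eq_Re_cinner positive_op_self_adjoint[OF assms(1)])
  have T_inner: "inner (T x) y = inner x (cadjoint T y)" for x y
    by (simp add: inner_eq_Re_cinner cinner_cadjoint[OF T])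
  interpret A: bounded_linear A by (rule A(1))
  define M where "M = closure (range A)"
  have M: "subspace M" "closed M"
    unfolding M_def by (auto intro!: subspace_closure linear_subspace_image A.linear_axioms)
  have M_scaleC: "c *\<^sub>C u \<in> M" if "u \<in> M" for c u
  proof -
    have "(*\<^sub>C) c ` M \<subseteq> M"
      unfolding M_def
    proof (rule image_closure_subset)
      show "continuous_on (closure (range A)) ((*\<^sub>C) c)"
        using bounded_linear_scaleC by (rule linear_continuous_on)
      show "(*\<^sub>C) c ` range A \<subseteq> closure (range A)"
        using closure_subset[of "range A"] by (auto simp flip: A(2))
    qed simp
    with that show ?thesis by blast
  qed
  \<comment> \<open>The bound against vectors \<open>A w\<close> extends by continuity to all of
    \<open>M\<close>, in particular to \<open>v\<close> itself.\<close>
  have dense: "norm v \<le> k"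
    if "v \<in> M" and *: "\<And>w. inner v (A w) \<le> k * norm (A w)" and "0 \<le> k" for v k
  proof -
    have "closed {u. inner v u \<le> k * norm u}"
      by (intro closed_Collect_le continuous_intros)
    then have "M \<subseteq> {u. inner v u \<le> k * norm u}"
      unfolding M_def using * by (intro closure_minimal) auto
    then have "norm v * norm v \<le> k * norm v"
      using \<open>v \<in> M\<close> by (auto simp: power2_norm_eq_inner simp flip: power2_eq_square)
    then show ?thesis
      using \<open>0 \<le> k\<close> by (cases "v = 0") auto
  qed
  \<comment> \<open>The difference \<open>u - v\<close> lies in \<open>M\<close> and is orthogonal
    to the range of \<open>A\<close>, so \<open>dense\<close> applies with
    \<open>k = 0\<close>.\<close>
  have inj: "u = v" if "u \<in> M" "v \<in> M" "A u = A v" for u v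
  proof -
    have "inner (u - v) (A w) = 0" for w
      using that by (simp add: A.diff flip: A_inner)
    then have "norm (u - v) \<le> 0"
      using that by (intro dense subspace_diff[OF M(1)]) auto
    then show ?thesis by simp
  qed
  have "\<exists>v\<in>M. A v = cadjoint T (A x)" for x
  proof -
    \<comment> \<open>Projecting a preimage \<open>y\<close> onto \<open>M\<close> changes it by a
      vector orthogonal to the range of \<open>A\<close>; self-adjointness puts that vector in the
      kernel of \<open>A\<close>.\<close>
    obtain y where y: "A y = cadjoint T (A x)"
      using ran unfolding image_subset_iff image_iff comp_def by (metis UNIV_I)
    obtain m where m: "m \<in> M" "\<And>u. u \<in> M \<Longrightarrow> inner (y - m) u = 0"
      using orthogonal_projection_exists[OF M] by blast
    have "inner (A (y - m)) w = 0" for w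
      unfolding A_inner using m(2) closure_subset[of "range A"] by (auto simp: M_def)
    then have "A (y - m) = 0" by (metis inner_eq_zero_iff)
    with y m(1) show ?thesis by (auto simp: A.diff)
  qed
  then obtain X where XM: "\<And>x. X x \<in> M" and AX: "\<And>x. A (X x) = cadjoint T (A x)"
    by metis
  have AX_inner: "inner (X x) (A w) = inner x (A (T w))" for x w
    by (metis A_inner AX T_inner inner_commute)
  \<comment> \<open>Values of \<open>X\<close> are determined by their inner products with the range
    of \<open>A\<close>; additivity and both kinds of homogeneity follow by checking these
    products.\<close>
  have X_eqI: "X x = v" if "v \<in> M" "\<And>w. inner v (A w) = inner x (A (T w))" for x v
  proof (rule inj)
    have "inner (A v) w = inner (A (X x)) w" for w
      unfolding A_inner AX_inner that(2) ..
    then show "A (X x) = A v" by (metis vector_eq_rdot)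
  qed (use XM that in auto)
  have "linear X"
    by (rule linearI; rule X_eqI)
      (use XM M(1) in \<open>auto simp: subspace_add subspace_scale inner_add_left AX_inner\<close>)
  have scale: "X (c *\<^sub>C x) = c *\<^sub>C X x" for c x
  proof (rule X_eqI)
    show "c *\<^sub>C X x \<in> M" using XM by (rule M_scaleC)
    have "cinner (X x) (A w) = cinner x (A (T w))" for w
      by (metis positive_op_self_adjoint[OF assms(1)] AX cinner_cadjoint[OF T] cinner_commute)
    then show "inner (c *\<^sub>C X x) (A w) = inner (c *\<^sub>C x) (A (T w))" for w
      by (simp add: inner_eq_Re_cinner cinner_scaleC_left)
  qed
  have "closed {x. norm (X x) \<le> real k}" for k :: nat
  proof -
    have "norm (X x) \<le> real k \<longleftrightarrow> (\<forall>w. inner x (A (T w)) \<le> real k * norm (A w))" for x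
    proof
      assume "norm (X x) \<le> real k"
      then have "norm (X x) * norm (A w) \<le> real k * norm (A w)" for w
        by (rule mult_right_mono) simp
      then show "\<forall>w. inner x (A (T w)) \<le> real k * norm (A w)"
        using AX_inner norm_cauchy_schwarz order_trans by metis
    next
      assume "\<forall>w. inner x (A (T w)) \<le> real k * norm (A w)"
      then show "norm (X x) \<le> real k"
        by (intro dense XM) (simp_all add: AX_inner)
    qed
    then have "{x. norm (X x) \<le> real k} = (\<Inter>w. {x. inner x (A (T w)) \<le> real k * norm (A w)})"
      by auto
    also have "closed \<dots>"
      by (intro closed_INT ballI closed_Collect_le continuous_intros)
    finally show ?thesis .
  qed
  then have "bounded_linear X"
    using \<open>linear X\<close> by (intro bounded_linear_if_closed_sublevels)
  then have X: "bounded_clinear X \<and> A \<circ> X = cadjoint T \<circ> A \<and> range X \<subseteq> closure (range A)"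
    using scale AX XM by (auto simp: bounded_clinear_def M_def)
  have "\<exists>!X. bounded_clinear X \<and> A \<circ> X = cadjoint T \<circ> A \<and> range X \<subseteq> closure (range A)"
  proof (rule ex1I[of _ X])
    fix Y assume Y: "bounded_clinear Y \<and> A \<circ> Y = cadjoint T \<circ> A \<and> range Y \<subseteq> closure (range A)"
    show "Y = X"
    proof (rule ext, rule inj)
      fix x
      show "Y x \<in> M" using Y by (auto simp: M_def)
      show "A (Y x) = A (X x)" using Y AX by (metis comp_apply)
    qed (rule XM)
  qed (rule X)
  then have "bounded_clinear (sharp_A A T) \<and> A \<circ> sharp_A A T = cadjoint T \<circ> A
      \<and> range (sharp_A A T) \<subseteq> closure (range A)"
    unfolding sharp_A_def by (rule theI')
  then show "bounded_clinear (sharp_A A T)" "A (sharp_A A T x) = cadjoint T (A x)"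
    by (auto simp: fun_eq_iff)
qed


lemma cinner_A_sharp_A:
  fixes A T :: "'a::complex_hilbert_space \<Rightarrow> 'a"
  assumes "positive_op A" "T \<in> B_A A"
  shows "cinner_A A (T x) y = cinner_A A x (sharp_A A T y)"
proof -
  have "bounded_clinear T" using assms(2) by (simp add: B_A_def)
  then show ?thesis
    by (simp add: cinner_A_def positive_op_self_adjoint[OF assms(1)] cinner_cadjoint
        sharp_A_bounded_clinear(2)[OF assms])
qed

section \<open>Boundedness in the A-seminorm and existence of A-unit vectors\<close>

lemma norm_A_le_norm:
  fixes A :: "'a::complex_hilbert_space \<Rightarrow> 'a"
  assumes "positive_op A"
  obtains K where "K \<ge> 0" "\<And>x. norm_A A x \<le> K * norm x"
proof -
  obtain B where "B \<ge> 0" and B: "\<And>x. norm (A x) \<le> norm x * B"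
    using assms bounded_linear.nonneg_bounded unfolding positive_op_def bounded_clinear_def by blast
  have "norm_A A x \<le> sqrt B * norm x" for x
  proof -
    have "Re (cinner_A A x x) = inner (A x) x"
      by (simp add: cinner_A_def inner_eq_Re_cinner)
    also have "\<dots> \<le> norm (A x) * norm x"
      by (rule norm_cauchy_schwarz)
    also have "\<dots> \<le> norm x * B * norm x"
      using B by (simp add: mult_right_mono)
    also have "\<dots> = B * (norm x)\<^sup>2"
      by (simp add: power2_eq_square)
    finally show ?thesis
      unfolding norm_A_def by (metis norm_ge_zero real_sqrt_le_iff real_sqrt_mult real_sqrt_unique)
  qed
  then show thesis using that[of "sqrt B"] \<open>B \<ge> 0\<close> by simp
qed

text \<open>Norm bounds on the iterates of \<open>S\<close> yield A-seminorm bounds with prefactor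
  \<open>K * norm x\<close>. The prefactor depends on \<open>x\<close>, but it drops out in
  \<open>symmetric_snorm_le\<close>, so \<open>M\<close> is uniform over A-unit vectors.\<close>

lemma norm_A_symmetric_bounded:
  fixes A S :: "'a::complex_hilbert_space \<Rightarrow> 'a"
  assumes "positive_op A" "bounded_linear S"
    and sym: "\<And>x y. cinner_A A (S x) y = cinner_A A x (S y)"
  obtains M where "M \<ge> 0" "\<And>x. norm_A A x = 1 \<Longrightarrow> norm_A A (S x) \<le> M"
proof -
  interpret csemi_inner "cinner_A A"
    using assms(1) by (rule csemi_inner_cinner_A)
  have snorm: "snorm = norm_A A"
    by (simp add: fun_eq_iff snorm_def norm_A_def)
  obtain K where "K \<ge> 0" and K: "\<And>x. norm_A A x \<le> K * norm x"
    using norm_A_le_norm[OF assms(1)] by blast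
  obtain M where "M \<ge> 0" and M: "\<And>k x. norm ((S ^^ k) x) \<le> M ^ k * norm x"
    using bounded_linear_funpow_bound[OF assms(2)] by blast
  have "norm_A A (S x) \<le> M" if "norm_A A x = 1" for x
  proof -
    have "norm_A A ((S ^^ k) x) \<le> (K * norm x) * M ^ k" for k
      using order_trans[OF K mult_left_mono[OF M \<open>K \<ge> 0\<close>]] by (simp add: mult_ac)
    then show ?thesis
      using symmetric_snorm_le[OF sym, of x "K * norm x" M] that \<open>M \<ge> 0\<close> by (simp add: snorm)
  qed
  with \<open>M \<ge> 0\<close> show thesis by (rule that)
qed

text \<open>If \<open>norm_A A x\<close> vanished, Cauchy-Schwarz against \<open>A x\<close> would
  give \<open>A x = 0\<close>. Hence any \<open>x\<close> outside the kernel of \<open>A\<close> can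
  be normalized.\<close>

lemma ex_norm_A_eq_1:
  fixes A :: "'a::complex_hilbert_space \<Rightarrow> 'a"
  assumes "positive_op A" "A \<noteq> (\<lambda>x. 0)"
  shows "\<exists>x. norm_A A x = 1"
proof -
  interpret csemi_inner "cinner_A A"
    using assms(1) by (rule csemi_inner_cinner_A)
  have snorm: "snorm = norm_A A"
    by (simp add: fun_eq_iff snorm_def norm_A_def)
  obtain x where "A x \<noteq> 0" using assms(2) by blast
  have "norm_A A x \<noteq> 0"
  proof
    assume "norm_A A x = 0"
    then have "cinner_A A x (A x) = 0"
      using cauchy_schwarz[of x "A x"] by (simp add: snorm)
    then have "inner (A x) (A x) = 0"
      by (simp add: cinner_A_def inner_eq_Re_cinner)
    with \<open>A x \<noteq> 0\<close> show False by simp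
  qed
  then have pos: "norm_A A x > 0"
    using snorm_nonneg[of x] by (simp add: snorm)
  define c where "c = complex_of_real (1 / norm_A A x)"
  have "(norm_A A (c *\<^sub>C x))\<^sup>2 = Re (c * cnj c * cinner_A A x x)"
    by (simp only: snorm_sq scaleC_left scaleC_right mult_ac flip: snorm)
  also have "\<dots> = 1"
    using pos self[of x] by (simp add: c_def snorm power2_eq_square)
  finally have "norm_A A (c *\<^sub>C x) = 1"
    using snorm_nonneg[of "c *\<^sub>C x"] by (simp add: snorm power2_eq_1_iff)
  then show ?thesis by blast
qed

section \<open>Passage from the pointwise inequality to the suprema\<close>

theorem theorem2p9:
  fixes A T :: "'a::complex_hilbert_space \<Rightarrow> 'a"
  assumes "positive_op A" and "A \<noteq> (\<lambda>x. 0)" and "T \<in> B_A A"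
  shows "davis_wielandt_radius_A A T \<le>
    1 / 2 * sqrt (
      numerical_radius_A A ((\<lambda>x. (sharp_A A T \<circ> T) x + T x) ^^ 2)
      + numerical_radius_A A ((\<lambda>x. (sharp_A A T \<circ> T) x - T x) ^^ 2)
      + numerical_radius_A A (\<lambda>x. (sharp_A A T \<circ> T) x
          + 2 *\<^sub>C ((sharp_A A T \<circ> T) ^^ 2) x + (T \<circ> sharp_A A T) x))"
proof -
  interpret csemi_inner "cinner_A A"
    using assms(1) by (rule csemi_inner_cinner_A)
  have snorm: "norm_A A = snorm"
    by (simp add: fun_eq_iff snorm_def norm_A_def)
  define X where "X = sharp_A A T"
  define S where "S = (\<lambda>x. X (T x))"
  define U where "U = (\<lambda>x. S x + T x)"
  define V where "V = (\<lambda>x. S x - T x)"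
  define W where "W = (\<lambda>x. S x + 2 *\<^sub>C S (S x) + T (X x))"
  have adj: "cinner_A A (T x) y = cinner_A A x (X y)" for x y
    unfolding X_def using assms(1,3) by (rule cinner_A_sharp_A)
  have adj': "cinner_A A (X x) y = cinner_A A x (T y)" for x y
    by (metis adj commute)
  have sym: "cinner_A A (S x) y = cinner_A A x (S y)" for x y
    by (simp add: S_def adj adj')
  have "bounded_linear T" "bounded_linear X"
    using assms(3) sharp_A_bounded_clinear(1)[OF assms(1,3)]
    by (auto simp: X_def B_A_def bounded_clinear_def)
  then have "bounded_linear S" "bounded_linear (\<lambda>x. T (X x))"
    unfolding S_def by (auto intro: bounded_linear_compose)
  then obtain M N where M: "M \<ge> 0" "\<And>x. snorm x = 1 \<Longrightarrow> snorm (S x) \<le> M"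
    and N: "N \<ge> 0" "\<And>x. snorm x = 1 \<Longrightarrow> snorm (T (X x)) \<le> N"
    using norm_A_symmetric_bounded[OF assms(1) _ sym]
      norm_A_symmetric_bounded[OF assms(1), of "\<lambda>x. T (X x)"]
    unfolding snorm by (metis adj adj')
  have Re_le: "Re (cinner_A A y x) \<le> snorm y" if "snorm x = 1" for x y
    using cauchy_schwarz[of y x] complex_Re_le_cmod[of "cinner_A A y x"] that by simp
  \<comment> \<open>A common bound on A-unit vectors for \<open>S + T\<close>, \<open>S - T\<close>
    and their adjoints \<open>S + X\<close>, \<open>S - X\<close>.\<close>
  define C where "C = M + sqrt M + sqrt N"
  \<comment> \<open>\<open>T\<close> need not be A-symmetric, so its bound comes from
    \<open>S\<close>: the square of \<open>snorm (T x)\<close> is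
    \<open>Re (cinner_A A (S x) x)\<close>, at most \<open>snorm (S x)\<close>. The bound for
    \<open>X\<close> comes from \<open>T (X x)\<close> likewise.\<close>
  have bT: "snorm (T x) \<le> sqrt M" if "snorm x = 1" for x
    using Re_le[OF that, of "S x"] M(2)[OF that]
    by (intro real_le_rsqrt) (simp add: snorm_sq S_def adj')
  have bX: "snorm (X x) \<le> sqrt N" if "snorm x = 1" for x
    using Re_le[OF that, of "T (X x)"] N(2)[OF that]
    by (intro real_le_rsqrt) (simp add: snorm_sq adj)
  have "cmod (cinner_A A ((U ^^ 2) x) x) \<le> C * C" if "snorm x = 1" for x
  proof (rule numerical_value_sq_bounded[OF _ _ _ that])
    show "cinner_A A (U x) y = cinner_A A x (S y + X y)" for x y
      by (simp add: U_def sesquilinear sym adj)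
    show "snorm (U x) \<le> C" "snorm (S x + X x) \<le> C" if "snorm x = 1" for x
      using snorm_add_le[of "S x" "T x"] snorm_add_le[of "S x" "X x"] M(1) N(1)
        M(2)[OF that] bT[OF that] bX[OF that]
        real_sqrt_ge_zero[OF M(1)] real_sqrt_ge_zero[OF N(1)]
      unfolding U_def C_def by linarith+
  qed
  then have U: "cmod (cinner_A A ((U ^^ 2) x) x) \<le> numerical_radius_A A (U ^^ 2)"
    if "snorm x = 1" for x
    unfolding numerical_radius_A_def snorm using that
    by (intro cSup_upper bdd_aboveI[of _ "C * C"]) auto
  have "cmod (cinner_A A ((V ^^ 2) x) x) \<le> C * C" if "snorm x = 1" for x
  proof (rule numerical_value_sq_bounded[OF _ _ _ that])
    show "cinner_A A (V x) y = cinner_A A x (S y - X y)" for x y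
      by (simp add: V_def sesquilinear sym adj)
    show "snorm (V x) \<le> C" "snorm (S x - X x) \<le> C" if "snorm x = 1" for x
      using snorm_diff_le[of "S x" "T x"] snorm_diff_le[of "S x" "X x"] M(1) N(1)
        M(2)[OF that] bT[OF that] bX[OF that]
        real_sqrt_ge_zero[OF M(1)] real_sqrt_ge_zero[OF N(1)]
      unfolding V_def C_def by linarith+
  qed
  then have V: "cmod (cinner_A A ((V ^^ 2) x) x) \<le> numerical_radius_A A (V ^^ 2)"
    if "snorm x = 1" for x
    unfolding numerical_radius_A_def snorm using that
    by (intro cSup_upper bdd_aboveI[of _ "C * C"]) auto
  have "cmod (cinner_A A (W x) x) \<le> M + 2 * (M * M) + N" if "snorm x = 1" for x
  proof -
    have "cinner_A A (W x) x
        = cinner_A A (S x) x + 2 * cinner_A A (S x) (S x) + cinner_A A (T (X x)) x"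
      by (simp add: W_def sesquilinear sym[of "S x"])
    also have "cmod \<dots> \<le> cmod (cinner_A A (S x) x) + 2 * cmod (cinner_A A (S x) (S x))
        + cmod (cinner_A A (T (X x)) x)"
      by (intro norm_triangle_le add_mono order_refl) (simp_all add: norm_mult)
    also have "\<dots> \<le> snorm (S x) + 2 * (snorm (S x) * snorm (S x)) + snorm (T (X x))"
      using cauchy_schwarz[of "S x" x] cauchy_schwarz[of "S x" "S x"]
        cauchy_schwarz[of "T (X x)" x] that by simp
    also have "\<dots> \<le> M + 2 * (M * M) + N"
      using M N that snorm_nonneg by (intro add_mono mult_mono) auto
    finally show ?thesis .
  qed
  then have W: "cmod (cinner_A A (W x) x) \<le> numerical_radius_A A W" if "snorm x = 1" for x
    unfolding numerical_radius_A_def snorm using that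
    by (intro cSup_upper bdd_aboveI[of _ "M + 2 * (M * M) + N"]) auto
  define R where
    "R = numerical_radius_A A (U ^^ 2) + numerical_radius_A A (V ^^ 2) + numerical_radius_A A W"
  have "sqrt ((cmod (cinner_A A (T x) x))\<^sup>2 + snorm (T x) ^ 4) \<le> 1 / 2 * sqrt R"
    if "snorm x = 1" for x
  proof -
    have "(cmod (cinner_A A (T x) x))\<^sup>2 + snorm (T x) ^ 4
        \<le> (cmod (cinner_A A ((U ^^ 2) x) x) + cmod (cinner_A A ((V ^^ 2) x) x)
          + cmod (cinner_A A (W x) x)) / 4"
      using davis_wielandt_pointwise[OF adj that] by (simp only: U_def V_def W_def S_def)
    also have "\<dots> \<le> R / 4"
      unfolding R_def by (intro divide_right_mono add_mono U V W that) simp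
    finally have "(cmod (cinner_A A (T x) x))\<^sup>2 + snorm (T x) ^ 4 \<le> R / 4" .
    then have "sqrt ((cmod (cinner_A A (T x) x))\<^sup>2 + snorm (T x) ^ 4) \<le> sqrt (R / 4)"
      by (rule real_sqrt_le_mono)
    then show ?thesis by (simp add: real_sqrt_divide)
  qed
  \<comment> \<open>A real supremum is bounded by an upper bound only when its set is nonempty,
    hence the appeal to an A-unit vector.\<close>
  then have "davis_wielandt_radius_A A T \<le> 1 / 2 * sqrt R"
    unfolding davis_wielandt_radius_A_def snorm
    using ex_norm_A_eq_1[OF assms(1,2)] by (intro cSup_least) (auto simp: snorm)
  then show ?thesis
    by (simp add: R_def U_def V_def W_def S_def X_def numeral_2_eq_2)
qed

end
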